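(* Let $P$ be a finite irreducible Markov chain on $V$ with stationary distribution $\pi$ and time-reversal $P^*$. For every nonempty proper subset $A\subset V$, $$\sqrt{\tilde\Phi_{PP^*}(A)}\ \ge\ \tilde\phi(A)\ \ge\ 1-\sqrt{1-\tilde\Phi_{PP^*}(A)}\ \ge\ \tfrac12\,\tilde\Phi_{PP^*}(A).$$
   Context: $P^*(x,y)=\frac{\pi(y)P(y,x)}{\pi(x)}$. For a kernel $K$ with stationary distribution $\pi$, $Q_K(A,B)=\sum_{x\in A,y\in B}\pi(x)K(x,y)$ and $\tilde\Phi_K(A)=\frac{Q_K(A,A^c)}{\pi(A)\pi(A^c)}$; $Q=Q_P$, $Q(A,y)=Q(A,\{y\})$. For $0\le t<1$, $$\Psi(A,t)=\min_{\substack{B\subset V,\ v\in V\\ \pi(B)\le t,\ \pi(B\cup\{v\})>t}}\ Q(A,B)+(t-\pi(B))\frac{Q(A,v)}{\pi(v)},$$ $\Psi(A)=\Psi(A,\pi(A^c))$, and $\tilde\phi(A)=\frac{\Psi(A)}{\pi(A)\pi(A^c)}$ (for the chain $P$). *)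

theory Defs
  imports Complex_Main
begin

text \<open>
  The state space \<open>V\<close> is a type of class \<^class>\<open>finite\<close>, so complements of sets of states are
  written \<open>- A\<close>.  A kernel is a real-valued function \<open>K x y\<close> (probability to move from \<open>x\<close>
  to \<open>y\<close>).
\<close>

definition markov_kernel :: "('v::finite \<Rightarrow> 'v \<Rightarrow> real) \<Rightarrow> bool" where
  "markov_kernel K \<longleftrightarrow> (\<forall>x y. 0 \<le> K x y) \<and> (\<forall>x. (\<Sum>y\<in>UNIV. K x y) = 1)"

definition kernel_comp ::
    "('v::finite \<Rightarrow> 'v \<Rightarrow> real) \<Rightarrow> ('v \<Rightarrow> 'v \<Rightarrow> real) \<Rightarrow> 'v \<Rightarrow> 'v \<Rightarrow> real" where
  "kernel_comp K L x y = (\<Sum>z\<in>UNIV. K x z * L z y)"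

primrec kernel_power :: "('v::finite \<Rightarrow> 'v \<Rightarrow> real) \<Rightarrow> nat \<Rightarrow> 'v \<Rightarrow> 'v \<Rightarrow> real" where
  "kernel_power K 0 = (\<lambda>x y. if x = y then 1 else 0)"
| "kernel_power K (Suc n) = kernel_comp K (kernel_power K n)"

definition irreducible_kernel :: "('v::finite \<Rightarrow> 'v \<Rightarrow> real) \<Rightarrow> bool" where
  "irreducible_kernel K \<longleftrightarrow> (\<forall>x y. \<exists>n. 0 < kernel_power K n x y)"

definition stationary_distribution ::
    "('v::finite \<Rightarrow> 'v \<Rightarrow> real) \<Rightarrow> ('v \<Rightarrow> real) \<Rightarrow> bool" where
  "stationary_distribution K p \<longleftrightarrow>
     (\<forall>x. 0 \<le> p x) \<and> (\<Sum>x\<in>UNIV. p x) = 1 \<and> (\<forall>y. (\<Sum>x\<in>UNIV. p x * K x y) = p y)"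

definition time_reversal ::
    "('v::finite \<Rightarrow> real) \<Rightarrow> ('v \<Rightarrow> 'v \<Rightarrow> real) \<Rightarrow> 'v \<Rightarrow> 'v \<Rightarrow> real" where
  "time_reversal p K x y = p y * K y x / p x"

text \<open>
  In what follows \<open>p\<close> is the stationary distribution of the kernel, and \<open>sum p A\<close> is the
  measure of a set \<open>A\<close> of states.
\<close>

definition ergodic_flow ::
    "('v::finite \<Rightarrow> real) \<Rightarrow> ('v \<Rightarrow> 'v \<Rightarrow> real) \<Rightarrow> 'v set \<Rightarrow> 'v set \<Rightarrow> real" where
  "ergodic_flow p K A B = (\<Sum>x\<in>A. \<Sum>y\<in>B. p x * K x y)"

definition conductance ::
    "('v::finite \<Rightarrow> real) \<Rightarrow> ('v \<Rightarrow> 'v \<Rightarrow> real) \<Rightarrow> 'v set \<Rightarrow> real" where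
  "conductance p K A = ergodic_flow p K A (- A) / (sum p A * sum p (- A))"

text \<open>
  The minimum below is over a finite set, which is nonempty when \<open>p\<close> is a probability
  distribution and \<open>0 \<le> t < 1\<close>; outside that range the value is unspecified.
\<close>

definition Psi_at ::
    "('v::finite \<Rightarrow> real) \<Rightarrow> ('v \<Rightarrow> 'v \<Rightarrow> real) \<Rightarrow> 'v set \<Rightarrow> real \<Rightarrow> real" where
  "Psi_at p K A t =
     Min {ergodic_flow p K A B + (t - sum p B) * (ergodic_flow p K A {v} / p v) | B v.
            sum p B \<le> t \<and> sum p (B \<union> {v}) > t}"

definition Psi ::
    "('v::finite \<Rightarrow> real) \<Rightarrow> ('v \<Rightarrow> 'v \<Rightarrow> real) \<Rightarrow> 'v set \<Rightarrow> real" where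
  "Psi p K A = Psi_at p K A (sum p (- A))"

definition modified_conductance ::
    "('v::finite \<Rightarrow> real) \<Rightarrow> ('v \<Rightarrow> 'v \<Rightarrow> real) \<Rightarrow> 'v set \<Rightarrow> real" where
  "modified_conductance p K A = Psi p K A / (sum p A * sum p (- A))"

end

theory Submission
  imports Defs "HOL-Analysis.Convex"
begin

text \<open>
  Put \<open>q z = Q(A,z) / \<pi>(z)\<close>, so \<open>0 \<le> q \<le> 1\<close>, \<open>\<Sum> \<pi> q = \<pi>(A)\<close> and \<open>Q\<^bsub>PP*\<^esub>(A,A\<^sup>c) = \<Sum> \<pi> q (1 - q)\<close>.
  An admissible pair \<open>(B,v)\<close> is a weight \<open>w\<close> with values in \<open>[0,1]\<close> and mean \<open>\<pi>(A\<^sup>c)\<close> (all of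
  \<open>B\<close>, a fraction of \<open>v\<close>), whose value in \<open>\<Psi>\<close> is \<open>\<Sum> \<pi> w q\<close>. In these terms
  \<open>1 - \<Phi> = Var q / (\<pi>(A) \<pi>(A\<^sup>c))\<close> and \<open>1 - \<phi> = - Cov(w,q) / (\<pi>(A) \<pi>(A\<^sup>c))\<close>, so Cauchy-Schwarz
  together with \<open>Var w \<le> \<pi>(A) \<pi>(A\<^sup>c)\<close> gives the lower bound on \<open>\<phi>\<close>. For the upper bound take for
  \<open>(B,v)\<close> a sublevel set of \<open>q\<close> with threshold \<open>c = q v\<close>; as \<open>\<Sum> \<pi> w q = \<Sum> \<pi> (1 - w) (1 - q)\<close>,
  bounding \<open>1 - q \<ge> 1 - c\<close> where \<open>w > 0\<close> and \<open>q \<ge> c\<close> where \<open>w < 1\<close> yields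
  \<open>\<Sum> \<pi> q (1 - q) \<ge> \<Sum> \<pi> w q\<close>, that is \<open>\<Phi> \<ge> \<phi>\<close>, and \<open>\<surd>\<Phi> \<ge> \<Phi>\<close> since \<open>\<Phi> \<le> 1\<close>.
\<close>

subsection \<open>Weighted means\<close>

lemma weighted_covariance_eq:
  fixes p f g :: "'a::finite \<Rightarrow> real"
  assumes "(\<Sum>x\<in>UNIV. p x) = 1"
  defines "F \<equiv> \<Sum>x\<in>UNIV. p x * f x" and "G \<equiv> \<Sum>x\<in>UNIV. p x * g x"
  shows "(\<Sum>x\<in>UNIV. p x * ((f x - F) * (g x - G))) = (\<Sum>x\<in>UNIV. p x * (f x * g x)) - F * G"
proof -
  have "(\<Sum>x\<in>UNIV. p x * ((f x - F) * (g x - G)))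
      = (\<Sum>x\<in>UNIV. p x * (f x * g x) - G * (p x * f x) - F * (p x * g x) + F * G * p x)"
    by (intro sum.cong refl) (simp add: algebra_simps)
  also have "\<dots> = (\<Sum>x\<in>UNIV. p x * (f x * g x)) - G * F - F * G + F * G * (\<Sum>x\<in>UNIV. p x)"
    unfolding F_def G_def by (simp only: sum.distrib sum_subtractf sum_distrib_left)
  finally show ?thesis
    using assms(1) by simp
qed

text \<open>Cauchy-Schwarz for the vectors \<open>sqrt (p x) * (f x - F)\<close> and
  \<open>sqrt (p x) * (g x - G)\<close>: splitting the weight evenly makes their inner product the
  covariance and their squared norms the variances.\<close>

lemma weighted_covariance_square_le:
  fixes p f g :: "'a::finite \<Rightarrow> real"
  assumes "\<And>x. 0 \<le> p x" and "(\<Sum>x\<in>UNIV. p x) = 1"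
  defines "F \<equiv> \<Sum>x\<in>UNIV. p x * f x" and "G \<equiv> \<Sum>x\<in>UNIV. p x * g x"
  shows "((\<Sum>x\<in>UNIV. p x * (f x * g x)) - F * G)\<^sup>2
      \<le> ((\<Sum>x\<in>UNIV. p x * (f x)\<^sup>2) - F\<^sup>2) * ((\<Sum>x\<in>UNIV. p x * (g x)\<^sup>2) - G\<^sup>2)"
proof -
  have s: "sqrt (p x) * u * (sqrt (p x) * v) = p x * (u * v)" for x u v
  proof -
    have "sqrt (p x) * u * (sqrt (p x) * v) = (sqrt (p x) * sqrt (p x)) * (u * v)"
      by (simp only: mult.assoc mult.left_commute)
    then show ?thesis
      using assms(1)[of x] by simp
  qed
  have "(\<Sum>x\<in>UNIV. (sqrt (p x) * (f x - F)) * (sqrt (p x) * (g x - G)))\<^sup>2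
      \<le> (\<Sum>x\<in>UNIV. (sqrt (p x) * (f x - F))\<^sup>2) * (\<Sum>x\<in>UNIV. (sqrt (p x) * (g x - G))\<^sup>2)"
    by (rule Cauchy_Schwarz_ineq_sum)
  then show ?thesis
    unfolding power2_eq_square[of "sqrt _ * _"] s
    using assms(2) by (simp add: F_def G_def weighted_covariance_eq power2_eq_square)
qed

lemma weighted_mean_square_le:
  fixes p f :: "'a::finite \<Rightarrow> real"
  assumes "\<And>x. 0 \<le> p x" and "(\<Sum>x\<in>UNIV. p x) = 1"
  shows "(\<Sum>x\<in>UNIV. p x * f x)\<^sup>2 \<le> (\<Sum>x\<in>UNIV. p x * (f x)\<^sup>2)"
proof -
  have "0 \<le> (\<Sum>x\<in>UNIV. p x * ((f x - (\<Sum>x\<in>UNIV. p x * f x)) * (f x - (\<Sum>x\<in>UNIV. p x * f x))))"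
    using assms(1) by (intro sum_nonneg mult_nonneg_nonneg zero_le_square) auto
  then show ?thesis
    using assms(2) by (simp add: weighted_covariance_eq power2_eq_square)
qed

text \<open>By \<open>mean\<close>, S is the mean of both \<open>w * q\<close> and
  \<open>(1 - w) * (1 - q)\<close>, so it may be written as \<open>(1 - c) * S + c * S\<close> with
  one form in each summand. This is compared pointwise with \<open>q * (1 - q)\<close>, split into
  the portions \<open>w\<close> and \<open>1 - w\<close>.\<close>

lemma threshold_weight_mean_le:
  fixes p w q :: "'a::finite \<Rightarrow> real"
  assumes p: "\<And>x. 0 \<le> p x" "(\<Sum>x\<in>UNIV. p x) = 1"
    and w: "\<And>x. 0 \<le> w x" "\<And>x. w x \<le> 1"
    and q: "\<And>x. 0 \<le> q x" "\<And>x. q x \<le> 1"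
    and below: "\<And>x. w x > 0 \<Longrightarrow> q x \<le> c"
    and above: "\<And>x. w x < 1 \<Longrightarrow> c \<le> q x"
    and mean: "(\<Sum>x\<in>UNIV. p x * w x) + (\<Sum>x\<in>UNIV. p x * q x) = 1"
  shows "(\<Sum>x\<in>UNIV. p x * (w x * q x)) \<le> (\<Sum>x\<in>UNIV. p x * (q x * (1 - q x)))"
proof -
  define S where "S = (\<Sum>x\<in>UNIV. p x * (w x * q x))"
  have "(\<Sum>x\<in>UNIV. p x * ((1 - w x) * (1 - q x)))
      = (\<Sum>x\<in>UNIV. p x - p x * w x - p x * q x + p x * (w x * q x))"
    by (intro sum.cong refl) (simp add: algebra_simps)
  also have "\<dots> = S"
    using mean p(2) by (simp add: sum.distrib sum_subtractf S_def)
  finally have S': "(\<Sum>x\<in>UNIV. p x * ((1 - w x) * (1 - q x))) = S" .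
  have pt: "(1 - c) * (w x * q x) + c * ((1 - w x) * (1 - q x)) \<le> q x * (1 - q x)" for x
  proof -
    have "w x * q x * (1 - c) \<le> w x * q x * (1 - q x)"
      using below[of x] w(1)[of x] q(1)[of x]
      by (cases "w x = 0") (auto intro!: mult_left_mono)
    moreover have "(1 - w x) * (1 - q x) * c \<le> (1 - w x) * (1 - q x) * q x"
      using above[of x] w(2)[of x] q(2)[of x]
      by (cases "w x = 1") (auto intro!: mult_left_mono)
    ultimately show ?thesis
      by (simp add: algebra_simps)
  qed
  have "S = (1 - c) * S + c * S"
    by (simp add: algebra_simps)
  also have "\<dots> = (\<Sum>x\<in>UNIV. p x * ((1 - c) * (w x * q x) + c * ((1 - w x) * (1 - q x))))"
    by (subst (2) S'[symmetric], unfold S_def)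
      (simp add: sum_distrib_left sum.distrib distrib_left mult.left_commute)
  also have "\<dots> \<le> (\<Sum>x\<in>UNIV. p x * (q x * (1 - q x)))"
    by (intro sum_mono mult_left_mono pt p)
  finally show ?thesis
    unfolding S_def .
qed

text \<open>Take B of largest cardinality among the sets of measure at most \<open>t\<close> that
  lie below their complement in the order of \<open>q\<close>, and v minimising \<open>q\<close>
  outside B. Adding v keeps the order condition, so by maximality it must push the measure above
  \<open>t\<close>.\<close>

lemma exists_sublevel_split:
  fixes p q :: "'a::finite \<Rightarrow> real"
  assumes "0 \<le> t" and "t < sum p UNIV"
  obtains B v where "sum p B \<le> t" and "t < sum p (B \<union> {v})"
    and "\<And>x. x \<in> B \<Longrightarrow> q x \<le> q v" and "\<And>x. x \<notin> B \<Longrightarrow> q v \<le> q x"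
proof -
  define good where "good B \<longleftrightarrow> sum p B \<le> t \<and> (\<forall>x\<in>B. \<forall>y\<in>-B. q x \<le> q y)" for B
  have "good {}"
    using assms(1) by (simp add: good_def)
  then obtain B where B: "good B" and max: "\<And>C. good C \<Longrightarrow> card C \<le> card B"
    using ex_has_greatest_nat[of good "{}" card "Suc (card (UNIV :: 'a set))"]
    by (metis card_mono finite subset_UNIV le_imp_less_Suc)
  have "B \<noteq> UNIV"
    using B assms(2) by (auto simp: good_def)
  then have "- B \<noteq> {}"
    by blast
  then obtain v where v: "v \<in> - B" and vmin: "\<And>x. x \<in> - B \<Longrightarrow> q v \<le> q x"
    using arg_min_if_finite[of "- B" q] finite[of "- B"] by (metis linorder_not_less)
  have "\<not> good (insert v B)"
    using max[of "insert v B"] v by auto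
  moreover have "q x \<le> q y" if "x \<in> insert v B" "y \<in> - insert v B" for x y
    using that B v vmin by (auto simp: good_def)
  ultimately have "t < sum p (B \<union> {v})"
    unfolding good_def by (metis Un_insert_right linorder_not_le sup_bot_right)
  then show thesis
    using that[of B v] B v vmin by (auto simp: good_def)
qed

lemma sum_fractional_indicator:
  fixes f :: "'a::finite \<Rightarrow> real"
  assumes "v \<notin> B"
  shows "(\<Sum>x\<in>UNIV. (if x \<in> B then 1 else if x = v then s else 0) * f x) = sum f B + s * f v"
proof -
  have "(\<Sum>x\<in>UNIV. (if x \<in> B then 1 else if x = v then s else 0) * f x)
      = (\<Sum>x\<in>UNIV. (if x \<in> B then f x else 0) + (if x = v then s * f x else 0))"
    using assms by (intro sum.cong) auto
  then show ?thesis
    by (simp add: sum.distrib flip: sum.inter_restrict)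
qed

subsection \<open>Flow into a state\<close>

lemma ergodic_flow_singleton: "ergodic_flow p K A {z} = (\<Sum>x\<in>A. p x * K x z)"
  by (simp add: ergodic_flow_def)

lemma ergodic_flow_eq_sum_singleton: "ergodic_flow p K A B = (\<Sum>z\<in>B. ergodic_flow p K A {z})"
  unfolding ergodic_flow_singleton unfolding ergodic_flow_def by (rule sum.swap)

lemma ergodic_flow_nonneg:
  assumes "markov_kernel K" and "stationary_distribution K p"
  shows "0 \<le> ergodic_flow p K A B"
  using assms by (auto simp: ergodic_flow_def markov_kernel_def stationary_distribution_def
      intro!: sum_nonneg)

lemma ergodic_flow_Compl_singleton:
  assumes "stationary_distribution K p"
  shows "ergodic_flow p K (- A) {z} = p z - ergodic_flow p K A {z}"
proof -
  have "p z = (\<Sum>x\<in>A \<union> - A. p x * K x z)"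
    using assms by (simp add: stationary_distribution_def)
  also have "\<dots> = ergodic_flow p K A {z} + ergodic_flow p K (- A) {z}"
    by (subst sum.union_disjoint) (auto simp: ergodic_flow_singleton)
  finally show ?thesis
    by simp
qed

lemma ergodic_flow_UNIV_right:
  assumes "markov_kernel K"
  shows "ergodic_flow p K A UNIV = sum p A"
  using assms by (simp add: ergodic_flow_def markov_kernel_def flip: sum_distrib_left)

text \<open>Sorting two-step paths by their middle state z, the summand
  \<open>p x * K x z * (p y * K y z) / p z\<close> factors into an x part and a y part. Both sides
  divide by the same \<open>p z\<close>, so a zero value does no harm.\<close>

lemma ergodic_flow_comp_time_reversal:
  "ergodic_flow p (kernel_comp K (time_reversal p K)) A B
     = (\<Sum>z\<in>UNIV. ergodic_flow p K A {z} * ergodic_flow p K B {z} / p z)"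
proof -
  have "ergodic_flow p (kernel_comp K (time_reversal p K)) A B
      = (\<Sum>x\<in>A. \<Sum>y\<in>B. \<Sum>z\<in>UNIV. p x * K x z * (p y * K y z) / p z)"
    by (simp add: ergodic_flow_def kernel_comp_def time_reversal_def sum_distrib_left mult.assoc)
  also have "\<dots> = (\<Sum>z\<in>UNIV. \<Sum>x\<in>A. \<Sum>y\<in>B. p x * K x z * (p y * K y z) / p z)"
    by (subst sum.swap[of _ UNIV]) (intro sum.cong refl sum.swap)
  finally show ?thesis
    by (simp add: ergodic_flow_singleton sum_product sum_divide_distrib)
qed

section \<open>Comparison of the two conductances\<close>

theorem lemma4p2p1:
  fixes P :: "'v::finite \<Rightarrow> 'v \<Rightarrow> real"
    and p :: "'v \<Rightarrow> real"
    and A :: "'v set"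
  assumes "markov_kernel P"
    and "irreducible_kernel P"
    and "stationary_distribution P p"
    and "A \<noteq> {}"
    and "A \<noteq> UNIV"
  shows "sqrt (conductance p (kernel_comp P (time_reversal p P)) A) \<ge> modified_conductance p P A
       \<and> modified_conductance p P A \<ge> 1 - sqrt (1 - conductance p (kernel_comp P (time_reversal p P)) A)
       \<and> 1 - sqrt (1 - conductance p (kernel_comp P (time_reversal p P)) A)
           \<ge> 1 / 2 * conductance p (kernel_comp P (time_reversal p P)) A"
proof -
  define a where "a = sum p A"
  define b where "b = sum p (- A)"
  define \<Phi> where "\<Phi> = conductance p (kernel_comp P (time_reversal p P)) A"
  define \<phi> where "\<phi> = modified_conductance p P A"
  define q where "q z = ergodic_flow p P A {z} / p z" for z
  have p0: "0 \<le> p x" and p1: "(\<Sum>x\<in>UNIV. p x) = 1" for x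
    using assms(3) by (auto simp: stationary_distribution_def)
  have ab1: "a + b = 1" and a0: "0 \<le> a" and b0: "0 \<le> b"
    using p0 p1 sum.union_disjoint[of A "- A" p] by (auto simp: a_def b_def intro!: sum_nonneg)
  have flow0: "0 \<le> ergodic_flow p P A {z}" and flow1: "ergodic_flow p P A {z} \<le> p z" for z
    using ergodic_flow_nonneg[OF assms(1,3), of A "{z}"]
      ergodic_flow_nonneg[OF assms(1,3), of "- A" "{z}"]
      ergodic_flow_Compl_singleton[OF assms(3), of A z] by auto
  have q0: "0 \<le> q z" and q1: "q z \<le> 1" for z
    using flow0[of z] flow1[of z] p0[of z] by (auto simp: q_def divide_le_eq_1)
  \<comment> \<open>Where \<open>p z = 0\<close>, the flow is squeezed between 0 and
    \<open>p z\<close> and vanishes too.\<close>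
  have pq: "ergodic_flow p P A {z} = p z * q z" for z
    using flow0[of z] flow1[of z] by (cases "p z = 0") (auto simp: q_def)
  have mean_q: "(\<Sum>z\<in>UNIV. p z * q z) = a"
    using ergodic_flow_eq_sum_singleton[of p P A UNIV] ergodic_flow_UNIV_right[OF assms(1), of p A]
    by (simp add: pq a_def)
  have "ergodic_flow p (kernel_comp P (time_reversal p P)) A (- A)
      = (\<Sum>z\<in>UNIV. p z * (q z * (1 - q z)))"
    unfolding ergodic_flow_comp_time_reversal ergodic_flow_Compl_singleton[OF assms(3)] pq
    by (intro sum.cong refl) (simp add: right_diff_distrib diff_divide_distrib)
  then have \<Phi>: "\<Phi> = (\<Sum>z\<in>UNIV. p z * (q z * (1 - q z))) / (a * b)"
    by (simp add: \<Phi>_def conductance_def a_def b_def)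

  define W where "W w \<longleftrightarrow> (\<forall>z. 0 \<le> w z \<and> w z \<le> 1) \<and> (\<Sum>z\<in>UNIV. p z * w z) = b"
    for w :: "'v \<Rightarrow> real"
  define val where "val B v = ergodic_flow p P A B
      + (b - sum p B) * (ergodic_flow p P A {v} / p v)" for B v
  define adm where "adm B v \<longleftrightarrow> sum p B \<le> b \<and> sum p (B \<union> {v}) > b" for B v
  define wt where "wt B v z = (if z \<in> B then 1 else if z = v then (b - sum p B) / p v else 0)"
    for B v and z :: 'v
  have wt: "W (wt B v)" "(\<Sum>z\<in>UNIV. p z * (wt B v z * q z)) = val B v" if "adm B v" for B v
  proof -
    have v: "v \<notin> B"
      using that by (auto simp: adm_def insert_absorb)
    \<comment> \<open>Since v lies outside B, its mass exceeds the missing mass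
      \<open>b - sum p B\<close>; hence \<open>p v > 0\<close> and the fraction of v taken by
      \<open>wt\<close> is in [0,1).\<close>
    then have pv: "p v > b - sum p B" "0 \<le> b - sum p B"
      using that by (auto simp: adm_def)
    have "(\<Sum>z\<in>UNIV. p z * wt B v z) = sum p B + (b - sum p B) / p v * p v"
      unfolding sum_fractional_indicator[OF v, symmetric] wt_def by (simp add: mult.commute)
    then show "W (wt B v)"
      using pv by (auto simp: W_def wt_def)
    have "(\<Sum>z\<in>UNIV. p z * (wt B v z * q z)) = (\<Sum>z\<in>UNIV. wt B v z * (p z * q z))"
      by (simp add: mult.left_commute)
    also have "\<dots> = (\<Sum>z\<in>B. p z * q z) + (b - sum p B) / p v * (p v * q v)"
      unfolding wt_def by (rule sum_fractional_indicator[OF v])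
    also have "\<dots> = val B v"
      unfolding val_def ergodic_flow_eq_sum_singleton[of p P A B] pq by simp
    finally show "(\<Sum>z\<in>UNIV. p z * (wt B v z * q z)) = val B v" .
  qed
  have Psi: "Psi p P A = Min {val B v | B v. adm B v}"
    by (simp add: Psi_def Psi_at_def val_def adm_def b_def)
  have fin: "finite {val B v | B v. adm B v}"
    by (rule finite_subset[of _ "(\<lambda>(B, v). val B v) ` UNIV"]) auto

  show ?thesis
  proof (cases "a * b = 0")
    \<comment> \<open>Division by zero makes both conductances 0, and every inequality becomes
      \<open>0 \<le> 0\<close>.\<close>
    case True
    then show ?thesis
      by (auto simp: conductance_def modified_conductance_def a_def b_def)
  next
    case False
    then have ab: "0 < a * b" and b1: "b < 1"
      using a0 b0 ab1 by auto
    have var: "1 - \<Phi> = ((\<Sum>z\<in>UNIV. p z * (q z)\<^sup>2) - a\<^sup>2) / (a * b)"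
    proof -
      have s: "(\<Sum>z\<in>UNIV. p z * (q z * (1 - q z))) = a - (\<Sum>z\<in>UNIV. p z * (q z)\<^sup>2)"
        by (simp add: algebra_simps sum_subtractf mean_q power2_eq_square)
      have "1 - \<Phi> = (a * b - (a - (\<Sum>z\<in>UNIV. p z * (q z)\<^sup>2))) / (a * b)"
        unfolding \<Phi> s using False by (subst diff_divide_distrib) simp
      moreover have "a * b = a - a\<^sup>2"
        unfolding power2_eq_square using ab1 by algebra
      ultimately show ?thesis
        by simp
    qed
    have "0 \<le> 1 - \<Phi>"
      unfolding var using ab weighted_mean_square_le[OF p0 p1, of q] by (simp add: mean_q)
    then have \<Phi>1: "\<Phi> \<le> 1"
      by simp
    have \<Phi>0: "0 \<le> \<Phi>"
      unfolding \<Phi> using ab p0 q0 q1 by (intro divide_nonneg_pos sum_nonneg mult_nonneg_nonneg) auto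
    have "b < sum p UNIV"
      using b1 p1 by simp
    then obtain B v where adm: "adm B v"
      and below: "\<And>x. x \<in> B \<Longrightarrow> q x \<le> q v" and above: "\<And>x. x \<notin> B \<Longrightarrow> q v \<le> q x"
      unfolding adm_def by (rule exists_sublevel_split[OF b0, of p q]) simp
    \<comment> \<open>Two pairs are in play: the sublevel pair \<open>(B, v)\<close> bounds the
      minimum from above, while \<open>(C, u)\<close> attains it and serves the lower bound.\<close>
    have "Psi p P A \<in> {val B v | B v. adm B v}"
      unfolding Psi using fin adm by (intro Min_in) blast+
    then obtain C u where C: "adm C u" "Psi p P A = val C u"
      by auto

    have "Psi p P A \<le> val B v"
      unfolding Psi using fin adm by (intro Min_le) blast+
    also have "\<dots> = (\<Sum>z\<in>UNIV. p z * (wt B v z * q z))"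
      using wt(2)[OF adm] by simp
    also have "\<dots> \<le> (\<Sum>z\<in>UNIV. p z * (q z * (1 - q z)))"
    proof (rule threshold_weight_mean_le[of _ _ _ "q v"])
      \<comment> \<open>Positive weight means x is in B or equals v; weight below 1 means x is
        outside B. At v itself both bounds are equalities.\<close>
      show "q x \<le> q v" if "wt B v x > 0" for x
        using that below by (auto simp: wt_def split: if_splits)
      show "q v \<le> q x" if "wt B v x < 1" for x
        using that above by (auto simp: wt_def split: if_splits)
    qed (use wt(1)[OF adm] mean_q ab1 in \<open>simp_all add: W_def p0 p1 q0 q1\<close>)
    finally have "\<phi> \<le> \<Phi>"
      using ab unfolding \<Phi> \<phi>_def modified_conductance_def a_def[symmetric] b_def[symmetric]
      by (simp add: divide_right_mono)
    also have "\<Phi> \<le> sqrt \<Phi>"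
      using \<Phi>0 \<Phi>1 by (intro real_le_rsqrt) (simp add: power2_eq_square mult_left_le)
    finally have 1: "\<phi> \<le> sqrt \<Phi>" .

    define w where "w = wt C u"
    have w0: "0 \<le> w z" and w1: "w z \<le> 1" and mean_w: "(\<Sum>z\<in>UNIV. p z * w z) = b" for z
      using wt(1)[OF C(1)] by (auto simp: W_def w_def)
    \<comment> \<open>Values in [0,1] give \<open>w^2 \<le> w\<close>, so the variance of
      \<open>w\<close> is at most \<open>b - b^2 = a * b\<close>.\<close>
    have "(\<Sum>z\<in>UNIV. p z * (w z)\<^sup>2) \<le> (\<Sum>z\<in>UNIV. p z * w z)"
      using w0 w1 p0 by (intro sum_mono mult_left_mono) (auto simp: power2_eq_square mult_left_le)
    moreover have "b = a * b + b\<^sup>2"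
      unfolding power2_eq_square using ab1 by algebra
    ultimately have var_w: "(\<Sum>z\<in>UNIV. p z * (w z)\<^sup>2) - b\<^sup>2 \<le> a * b"
      using mean_w by simp
    have \<phi>: "1 - \<phi> = (b * a - Psi p P A) / (a * b)"
      using False
      by (simp add: \<phi>_def modified_conductance_def diff_divide_distrib mult.commute
          flip: a_def b_def)
    have "(Psi p P A - b * a)\<^sup>2
        \<le> ((\<Sum>z\<in>UNIV. p z * (w z)\<^sup>2) - b\<^sup>2) * ((\<Sum>z\<in>UNIV. p z * (q z)\<^sup>2) - a\<^sup>2)"
      using weighted_covariance_square_le[OF p0 p1, of w q] C wt(2)[OF C(1)]
      by (simp add: mean_w mean_q flip: w_def)
    also have "\<dots> \<le> (a * b) * ((\<Sum>z\<in>UNIV. p z * (q z)\<^sup>2) - a\<^sup>2)"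
      using var_w weighted_mean_square_le[OF p0 p1, of q]
      by (intro mult_right_mono) (auto simp: mean_q)
    also have "\<dots> = (1 - \<Phi>) * (a * b)\<^sup>2"
      using False unfolding var power2_eq_square[of "a * b"] by simp
    finally have "(1 - \<phi>)\<^sup>2 \<le> 1 - \<Phi>"
      using \<Phi>1 unfolding \<phi> power_divide by (simp add: divide_le_eq power2_commute)
    \<comment> \<open>The root may be taken whatever the sign of \<open>1 - \<phi>\<close>.\<close>
    then have 2: "1 - \<phi> \<le> sqrt (1 - \<Phi>)"
      by (rule real_le_rsqrt)

    \<comment> \<open>The two sides differ by \<open>\<Phi>^2 / 4\<close>; the root of the right one
      is \<open>1 - \<Phi> / 2\<close> because \<open>\<Phi> \<le> 1\<close> makes it
      nonnegative.\<close>
    have "1 - \<Phi> \<le> (1 - \<Phi> / 2)\<^sup>2"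
      by (simp add: power2_eq_square algebra_simps)
    then have "sqrt (1 - \<Phi>) \<le> 1 - \<Phi> / 2"
      using \<Phi>1 by (intro real_le_lsqrt) auto
    with 1 2 show ?thesis
      unfolding \<Phi>_def \<phi>_def by auto
  qed
qed

end
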